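(* Let $(A,\nu)$ be a standard probability space, let $X=A^{\mathbb{Z}}$ be the space of two-sided sequences, $\mu=\nu^{\mathbb{Z}}$ the product measure on $X$, and $T\colon X\to X$ the left shift. If the measure $\nu$ does not have atoms, then the sequence $h_n=n$ is a scaling entropy sequence of the Bernoulli shift $(X,\mu,T)$.
   Context: A standard probability space is a Lebesgue--Rokhlin space; its measure may have atoms. A semimetric $\rho$ on $X$ is a nonnegative symmetric function on $X\times X$ that vanishes on the diagonal and satisfies the triangle inequality (distinct points may be at distance $0$). It is measurable if it is measurable on $(X^2,\mu^2)$ as a function of two variables. A measurable semimetric is admissible if there is a subset $X_1\subset X$ of full measure such that the semimetric space $(X_1,\rho)$ is separable. It is summable if $\int_{X\times X}\rho\,d(\mu\times\mu)<\infty$. Epsilon-entropy: for $\varepsilon>0$ let $k\in\mathbb{N}=\{1,2,\dots\}$ be the least number such that $X$ can be partitioned into disjoint measurable sets $X_0,X_1,\dots,X_k$ with $\mu(X_0)<\varepsilon$ and with the $\rho$-diameter of $X_j$ less than $\varepsilon$ for each $j=1,\dots,k$. Put $\mathbb{H}_\varepsilon(X,\mu,\rho)=\log_2 k$, and $\mathbb{H}_\varepsilon(X,\mu,\rho)=+\infty$ if no such $k$ exists. For $k\in\mathbb{Z}$ put $T^k\rho(x,y)=\rho(T^kx,T^ky)$, and for $n\ge 1$ put $T^n_{av}\rho=\frac1n\sum_{k=0}^{n-1}T^k\rho$. A measurable semimetric $\rho$ is (two-sided) generating for $(X,\mu,T)$ if there is a measurable set $X'\subset X$ of full measure such that for any two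 distinct $x,y\in X'$ there exists $k\in\mathbb{Z}$ with $T^k\rho(x,y)>0$. For an admissible semimetric $\rho$, a sequence $\{h_n\}$ of positive numbers is a scaling sequence for $\rho$ if for every $\varepsilon>0$ one has $\limsup_n \mathbb{H}_\varepsilon(X,\mu,T^n_{av}\rho)/h_n<+\infty$, and for all sufficiently small $\varepsilon>0$ one has $\liminf_n \mathbb{H}_\varepsilon(X,\mu,T^n_{av}\rho)/h_n>0$. A sequence of positive numbers is a scaling entropy sequence of $(X,\mu,T)$ if it is a scaling sequence for some (and then for any) summable admissible generating semimetric $\rho$ on $(X,\mu)$. *)

theory Defs
  imports "HOL-Probability.Probability"
begin

section \<open>Standard probability spaces\<close>

definition isomorphic_mod_0 :: "'a measure \<Rightarrow> 'b measure \<Rightarrow> bool" where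
  "isomorphic_mod_0 M N \<longleftrightarrow>
     (\<exists>A\<in>sets M. \<exists>B\<in>sets N. \<exists>f g.
        emeasure M (space M - A) = 0 \<and> emeasure N (space N - B) = 0 \<and>
        f \<in> measurable (restrict_space M A) (restrict_space N B) \<and>
        g \<in> measurable (restrict_space N B) (restrict_space M A) \<and>
        (\<forall>x\<in>A. g (f x) = x) \<and> (\<forall>y\<in>B. f (g y) = y) \<and>
        distr (restrict_space M A) (restrict_space N B) f = restrict_space N B)"

text \<open>
  The disjoint union of the interval from \<open>0\<close> to \<open>a\<close> with Lebesgue measure and of
  at most countably many points \<open>n\<close> of positive mass \<open>p n\<close>.
\<close>

definition interval_with_atoms :: "real \<Rightarrow> (nat \<Rightarrow> ennreal) \<Rightarrow> (real + nat) measure" where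
  "interval_with_atoms a p =
     measure_of (Inl ` {0..a} \<union> Inr ` {n. 0 < p n})
       {S. S \<subseteq> Inl ` {0..a} \<union> Inr ` {n. 0 < p n} \<and> Inl -` S \<in> sets lebesgue}
       (\<lambda>S. emeasure lebesgue (Inl -` S) + (\<Sum>n. p n * indicator S (Inr n)))"

text \<open>
  Lebesgue--Rokhlin spaces. The normalisation \<open>a + (\<Sum>n. p n) = 1\<close> is forced by the
  isomorphism, since \<open>M\<close> is a probability space.
\<close>

definition standard_prob_space :: "'a measure \<Rightarrow> bool" where
  "standard_prob_space M \<longleftrightarrow> prob_space M \<and> complete_measure M \<and>
     (\<exists>a\<ge>0. \<exists>p. isomorphic_mod_0 M (interval_with_atoms a p))"

definition is_atom :: "'a measure \<Rightarrow> 'a set \<Rightarrow> bool" where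
  "is_atom M A \<longleftrightarrow> A \<in> sets M \<and> 0 < emeasure M A \<and>
     (\<forall>B\<in>sets M. B \<subseteq> A \<longrightarrow> emeasure M B = 0 \<or> emeasure M B = emeasure M A)"


section \<open>Semimetrics\<close>

definition semimetric_on :: "'a set \<Rightarrow> ('a \<Rightarrow> 'a \<Rightarrow> real) \<Rightarrow> bool" where
  "semimetric_on X \<rho> \<longleftrightarrow>
     (\<forall>x\<in>X. \<forall>y\<in>X. 0 \<le> \<rho> x y) \<and>
     (\<forall>x\<in>X. \<forall>y\<in>X. \<rho> x y = \<rho> y x) \<and>
     (\<forall>x\<in>X. \<rho> x x = 0) \<and>
     (\<forall>x\<in>X. \<forall>y\<in>X. \<forall>z\<in>X. \<rho> x z \<le> \<rho> x y + \<rho> y z)"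

text \<open>
  The square of a Lebesgue--Rokhlin space is again complete, hence the completion of the
  binary product, whose \<open>\<sigma>\<close>-algebra is only the one generated by the rectangles.
\<close>

abbreviation square_measure :: "'a measure \<Rightarrow> ('a \<times> 'a) measure" where
  "square_measure M \<equiv> completion (M \<Otimes>\<^sub>M M)"

definition measurable_semimetric :: "'a measure \<Rightarrow> ('a \<Rightarrow> 'a \<Rightarrow> real) \<Rightarrow> bool" where
  "measurable_semimetric M \<rho> \<longleftrightarrow> semimetric_on (space M) \<rho> \<and>
     (\<lambda>(x, y). \<rho> x y) \<in> borel_measurable (square_measure M)"

definition full_measure_set :: "'a measure \<Rightarrow> 'a set \<Rightarrow> bool" where
  "full_measure_set M X \<longleftrightarrow> X \<in> sets M \<and> emeasure M (space M - X) = 0"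

definition separable_semimetric :: "'a set \<Rightarrow> ('a \<Rightarrow> 'a \<Rightarrow> real) \<Rightarrow> bool" where
  "separable_semimetric X \<rho> \<longleftrightarrow>
     (\<exists>D\<subseteq>X. countable D \<and> (\<forall>x\<in>X. \<forall>e>0. \<exists>d\<in>D. \<rho> x d < e))"

definition admissible_semimetric :: "'a measure \<Rightarrow> ('a \<Rightarrow> 'a \<Rightarrow> real) \<Rightarrow> bool" where
  "admissible_semimetric M \<rho> \<longleftrightarrow> measurable_semimetric M \<rho> \<and>
     (\<exists>X. full_measure_set M X \<and> separable_semimetric X \<rho>)"

definition summable_semimetric :: "'a measure \<Rightarrow> ('a \<Rightarrow> 'a \<Rightarrow> real) \<Rightarrow> bool" where
  "summable_semimetric M \<rho> \<longleftrightarrow>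
     (\<integral>\<^sup>+ (x, y). ennreal (\<rho> x y) \<partial>square_measure M) < \<infinity>"


section \<open>Epsilon-entropy\<close>

definition semimetric_diameter :: "('a \<Rightarrow> 'a \<Rightarrow> real) \<Rightarrow> 'a set \<Rightarrow> ennreal" where
  "semimetric_diameter \<rho> S = (SUP (x, y)\<in>S \<times> S. ennreal (\<rho> x y))"

definition eps_partition ::
    "'a measure \<Rightarrow> ('a \<Rightarrow> 'a \<Rightarrow> real) \<Rightarrow> real \<Rightarrow> nat \<Rightarrow> (nat \<Rightarrow> 'a set) \<Rightarrow> bool" where
  "eps_partition M \<rho> \<epsilon> k P \<longleftrightarrow>
     (\<forall>j\<le>k. P j \<in> sets M) \<and> disjoint_family_on P {..k} \<and> (\<Union>j\<le>k. P j) = space M \<and>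
     emeasure M (P 0) < ennreal \<epsilon> \<and>
     (\<forall>j\<in>{1..k}. semimetric_diameter \<rho> (P j) < ennreal \<epsilon>)"

definition eps_entropy :: "'a measure \<Rightarrow> ('a \<Rightarrow> 'a \<Rightarrow> real) \<Rightarrow> real \<Rightarrow> ereal" where
  "eps_entropy M \<rho> \<epsilon> =
     (if \<exists>k\<ge>1. \<exists>P. eps_partition M \<rho> \<epsilon> k P
      then ereal (log 2 (real (LEAST k. 1 \<le> k \<and> (\<exists>P. eps_partition M \<rho> \<epsilon> k P))))
      else \<infinity>)"


section \<open>Scaling entropy sequences\<close>

definition int_iterate :: "'a set \<Rightarrow> ('a \<Rightarrow> 'a) \<Rightarrow> int \<Rightarrow> 'a \<Rightarrow> 'a" where
  "int_iterate X T k =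
     (if 0 \<le> k then T ^^ nat k else inv_into X T ^^ nat (- k))"

definition translate_semimetric ::
    "'a set \<Rightarrow> ('a \<Rightarrow> 'a) \<Rightarrow> int \<Rightarrow> ('a \<Rightarrow> 'a \<Rightarrow> real) \<Rightarrow> 'a \<Rightarrow> 'a \<Rightarrow> real" where
  "translate_semimetric X T k \<rho> x y = \<rho> (int_iterate X T k x) (int_iterate X T k y)"

definition average_semimetric ::
    "'a set \<Rightarrow> ('a \<Rightarrow> 'a) \<Rightarrow> nat \<Rightarrow> ('a \<Rightarrow> 'a \<Rightarrow> real) \<Rightarrow> 'a \<Rightarrow> 'a \<Rightarrow> real" where
  "average_semimetric X T n \<rho> x y =
     1 / real n * (\<Sum>k<n. translate_semimetric X T (int k) \<rho> x y)"

definition generating_semimetric ::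
    "'a measure \<Rightarrow> ('a \<Rightarrow> 'a) \<Rightarrow> ('a \<Rightarrow> 'a \<Rightarrow> real) \<Rightarrow> bool" where
  "generating_semimetric M T \<rho> \<longleftrightarrow> measurable_semimetric M \<rho> \<and>
     (\<exists>X. full_measure_set M X \<and>
       (\<forall>x\<in>X. \<forall>y\<in>X. x \<noteq> y \<longrightarrow> (\<exists>k. 0 < translate_semimetric (space M) T k \<rho> x y)))"

text \<open>Sequences are indexed by \<open>n \<ge> 1\<close>; the value \<open>h 0\<close> is irrelevant.\<close>

definition scaling_sequence ::
    "'a measure \<Rightarrow> ('a \<Rightarrow> 'a) \<Rightarrow> ('a \<Rightarrow> 'a \<Rightarrow> real) \<Rightarrow> (nat \<Rightarrow> real) \<Rightarrow> bool" where
  "scaling_sequence M T \<rho> h \<longleftrightarrow> (\<forall>n\<ge>1. 0 < h n) \<and>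
     (\<forall>\<epsilon>>0. limsup (\<lambda>n. eps_entropy M (average_semimetric (space M) T n \<rho>) \<epsilon> / ereal (h n)) < \<infinity>) \<and>
     (\<forall>\<^sub>F \<epsilon> in at_right 0.
        0 < liminf (\<lambda>n. eps_entropy M (average_semimetric (space M) T n \<rho>) \<epsilon> / ereal (h n)))"

text \<open>
  Defined by some \<open>\<rho>\<close>; that every other summable admissible generating semimetric then has the same
  scaling sequences is a theorem, not part of the definition.
\<close>

definition scaling_entropy_sequence ::
    "'a measure \<Rightarrow> ('a \<Rightarrow> 'a) \<Rightarrow> (nat \<Rightarrow> real) \<Rightarrow> bool" where
  "scaling_entropy_sequence M T h \<longleftrightarrow>
     (\<exists>\<rho>. admissible_semimetric M \<rho> \<and> summable_semimetric M \<rho> \<and>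
          generating_semimetric M T \<rho> \<and> scaling_sequence M T \<rho> h)"


section \<open>Bernoulli shifts\<close>

definition bernoulli_measure :: "'a measure \<Rightarrow> (int \<Rightarrow> 'a) measure" where
  "bernoulli_measure \<nu> = completion (PiM UNIV (\<lambda>_. \<nu>))"

definition left_shift :: "(int \<Rightarrow> 'a) \<Rightarrow> int \<Rightarrow> 'a" where
  "left_shift x = (\<lambda>i. x (i + 1))"

end

theory Submission
  imports Defs
begin

text \<open>
  Let \<open>\<phi>\<close> be the isomorphism mod \<open>0\<close> of \<open>\<nu>\<close> with an interval; it has no atomic part,
  because \<open>\<nu>\<close> has no atoms. The semimetric \<open>\<bar>\<phi> (x 0) - \<phi> (y 0)\<bar>\<close> is generating, and its average is the
  normalised \<open>\<ell>\<^sup>1\<close> distance of \<open>n\<close> independent uniform coordinates. Cutting the interval into \<open>m\<close>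
  pieces gives a partition into \<open>m ^ n\<close> cells of small diameter. Conversely, a Chernoff bound shows
  that a ball of small radius has measure at most \<open>(3/4) ^ n\<close>, so exponentially many cells of
  small diameter are necessary.
\<close>

section \<open>The model space: an interval with atoms\<close>

text \<open>\<open>measure_of\<close> discards a set function that is not a measure, so the three
  formulas rest on checking the sigma-algebra axioms and countable additivity.\<close>

lemma
  shows space_interval_with_atoms:
      "space (interval_with_atoms a p) = Inl ` {0..a} \<union> Inr ` {n. 0 < p n}"
    and sets_interval_with_atoms:
      "sets (interval_with_atoms a p) =
        {S. S \<subseteq> Inl ` {0..a} \<union> Inr ` {n. 0 < p n} \<and> Inl -` S \<in> sets lebesgue}"
    and emeasure_interval_with_atoms:
      "S \<in> sets (interval_with_atoms a p) \<Longrightarrow>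
        emeasure (interval_with_atoms a p) S = emeasure lebesgue (Inl -` S) + (\<Sum>n. p n * indicator S (Inr n))"
proof -
  let ?\<Omega> = "Inl ` {0..a} \<union> Inr ` {n. 0 < p n} :: (real + nat) set"
  let ?\<A> = "{S. S \<subseteq> ?\<Omega> \<and> Inl -` S \<in> sets lebesgue}"
  let ?\<mu> = "\<lambda>S. emeasure lebesgue (Inl -` S) + (\<Sum>n. p n * indicator S (Inr n))"
  \<comment> \<open>The atomic sum becomes a weighted counting measure. Countable additivity then
    follows from that of two genuine measures, each applied to preimages.\<close>
  have \<mu>: "?\<mu> S = emeasure lebesgue (Inl -` S) + emeasure (density (count_space UNIV) p) (Inr -` S)"
    for S :: "(real + nat) set"
    by (auto simp: emeasure_density nn_integral_count_space_nat indicator_def intro!: suminf_cong)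
  have Inl_\<Omega>: "Inl -` ?\<Omega> = {0..a}" by auto
  have Inl_in_lebesgue: "Inl -` ?\<Omega> \<in> sets lebesgue"
    unfolding Inl_\<Omega> by simp
  interpret sigma_algebra ?\<Omega> ?\<A>
  proof (rule sigma_algebra_iff2[THEN iffD2], intro conjI ballI allI impI)
    show "?\<Omega> - S \<in> ?\<A>" if "S \<in> ?\<A>" for S
      using that Inl_in_lebesgue by (auto simp: vimage_Diff)
    show "(\<Union>i. S i) \<in> ?\<A>" if "range S \<subseteq> ?\<A>" for S :: "nat \<Rightarrow> (real + nat) set"
      using that by (auto simp: vimage_UN intro!: sets.countable_UN)
  qed auto
  have "countably_additive ?\<A> ?\<mu>"
    unfolding \<mu>
  proof (rule countably_additiveI)
    fix S :: "nat \<Rightarrow> (real + nat) set"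
    assume S: "range S \<subseteq> ?\<A>" "disjoint_family S"
    have disj: "disjoint_family (\<lambda>i. Inl -` S i)" "disjoint_family (\<lambda>i. Inr -` S i)"
      using S(2) unfolding disjoint_family_on_def by blast+
    have "(\<Sum>i. emeasure lebesgue (Inl -` S i) + emeasure (density (count_space UNIV) p) (Inr -` S i)) =
      (\<Sum>i. emeasure lebesgue (Inl -` S i)) + (\<Sum>i. emeasure (density (count_space UNIV) p) (Inr -` S i))"
      by (simp add: suminf_add)
    also have "(\<Sum>i. emeasure lebesgue (Inl -` S i)) = emeasure lebesgue (\<Union>i. Inl -` S i)"
      using S disj by (intro suminf_emeasure) auto
    also have "(\<Sum>i. emeasure (density (count_space UNIV) p) (Inr -` S i)) =
        emeasure (density (count_space UNIV) p) (\<Union>i. Inr -` S i)"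
      using S disj by (intro suminf_emeasure) auto
    finally show "(\<Sum>i. emeasure lebesgue (Inl -` S i) + emeasure (density (count_space UNIV) p) (Inr -` S i)) =
        emeasure lebesgue (Inl -` (\<Union>i. S i)) + emeasure (density (count_space UNIV) p) (Inr -` (\<Union>i. S i))"
      by (simp add: vimage_UN)
  qed
  moreover have "positive ?\<A> ?\<mu>" by (auto simp: positive_def)
  ultimately show
    "S \<in> sets (interval_with_atoms a p) \<Longrightarrow> emeasure (interval_with_atoms a p) S = ?\<mu> S"
    unfolding interval_with_atoms_def sets_measure_of_eq
    by (intro emeasure_measure_of_sigma) (auto intro: sigma_algebra_axioms)
  show "space (interval_with_atoms a p) = ?\<Omega>" "sets (interval_with_atoms a p) = ?\<A>"
    unfolding interval_with_atoms_def by simp_all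
qed

section \<open>Real coding of a space without atoms\<close>

text \<open>An atom of the model would be carried back to an atom of \<nu>, so the model is a bare
  interval. The isomorphism, read as a real function, then pushes \<nu> to a measure dominated by
  Lebesgue measure, and \<open>2 * \<delta>\<close> is the length of an interval of radius
  \<delta>.\<close>

lemma nonatomic_coding:
  assumes std: "standard_prob_space \<nu>" and na: "\<nexists>A. is_atom \<nu> A"
  obtains \<phi> :: "'a \<Rightarrow> real" and A a where
    "\<phi> \<in> borel_measurable \<nu>" "A \<in> sets \<nu>" "emeasure \<nu> (space \<nu> - A) = 0" "inj_on \<phi> A"
    "\<And>x. 0 \<le> \<phi> x" "\<And>x. \<phi> x \<le> a"
    "\<And>c \<delta>. 0 < \<delta> \<Longrightarrow> emeasure \<nu> {x \<in> space \<nu>. \<bar>\<phi> x - c\<bar> < \<delta>} \<le> ennreal (2 * \<delta>)"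
proof -
  from std obtain a p where a: "0 \<le> a" and iso: "isomorphic_mod_0 \<nu> (interval_with_atoms a p)"
    unfolding standard_prob_space_def by blast
  define N where "N = interval_with_atoms a p"
  obtain A B f g where A: "A \<in> sets \<nu>" and B: "B \<in> sets N"
    and A0: "emeasure \<nu> (space \<nu> - A) = 0" and B0: "emeasure N (space N - B) = 0"
    and f: "f \<in> restrict_space \<nu> A \<rightarrow>\<^sub>M restrict_space N B"
    and gf: "\<And>x. x \<in> A \<Longrightarrow> g (f x) = x" and fg: "\<And>y. y \<in> B \<Longrightarrow> f (g y) = y"
    and g: "g \<in> restrict_space N B \<rightarrow>\<^sub>M restrict_space \<nu> A"
    and df: "distr (restrict_space \<nu> A) (restrict_space N B) f = restrict_space N B"
    using iso unfolding isomorphic_mod_0_def N_def[symmetric] by blast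
  have As: "A \<subseteq> space \<nu>" and Bs: "B \<subseteq> space N" using A B sets.sets_into_space by auto
  have spA: "space (restrict_space \<nu> A) = A" and spB: "space (restrict_space N B) = B"
    using As Bs by (auto simp: space_restrict_space)
  have fB: "f x \<in> B" if "x \<in> A" for x using measurable_space[OF f, unfolded spA spB] that .
  have gA: "g y \<in> A" if "y \<in> B" for y using measurable_space[OF g, unfolded spA spB] that .
  \<comment> \<open>\<open>df\<close> speaks of the restrictions to \<open>A\<close> and
    \<open>B\<close>; for subsets of \<open>B\<close> it turns into a statement about the full
    measures.\<close>
  have transport: "{x \<in> A. f x \<in> S} \<in> sets \<nu> \<and> emeasure \<nu> {x \<in> A. f x \<in> S} = emeasure N S"
    if S: "S \<in> sets N" "S \<subseteq> B" for S
  proof -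
    have S': "S \<in> sets (restrict_space N B)" using S B by (simp add: sets_restrict_space_iff)
    have eq: "f -` S \<inter> space (restrict_space \<nu> A) = {x \<in> A. f x \<in> S}" unfolding spA by auto
    have m: "{x \<in> A. f x \<in> S} \<in> sets (restrict_space \<nu> A)"
      using measurable_sets[OF f S'] unfolding eq .
    then have m': "{x \<in> A. f x \<in> S} \<in> sets \<nu>" using A by (simp add: sets_restrict_space_iff)
    have "emeasure N S = emeasure (restrict_space N B) S"
      using S B by (simp add: emeasure_restrict_space)
    also have "\<dots> = emeasure (restrict_space \<nu> A) {x \<in> A. f x \<in> S}"
      by (subst df[symmetric]) (simp add: emeasure_distr[OF f S'] eq)
    also have "\<dots> = emeasure \<nu> {x \<in> A. f x \<in> S}"
      using A by (intro emeasure_restrict_space) auto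
    finally show ?thesis using m' by simp
  qed
  \<comment> \<open>A point of positive mass cannot lie in the null set outside \<open>B\<close>.
    Its preimage in \<open>A\<close> is the single point \<open>g (Inr n)\<close>, and a singleton
    of positive measure is an atom.\<close>
  have p0: "\<not> 0 < p n" for n
  proof
    assume n: "0 < p n"
    have S: "{Inr n} \<in> sets N"
      using n unfolding N_def sets_interval_with_atoms by (auto simp: vimage_def)
    have "p n = (\<Sum>k. p k * indicator {Inr n :: real + nat} (Inr k))"
      by (subst suminf_finite[of "{n}"]) auto
    also have "\<dots> = emeasure N {Inr n}"
      using S unfolding N_def by (subst emeasure_interval_with_atoms) (auto simp: vimage_def)
    finally have pos: "0 < emeasure N {Inr n}" using n by simp
    have "Inr n \<in> B"
    proof (rule ccontr)
      assume "Inr n \<notin> B"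
      then have "{Inr n} \<subseteq> space N - B" using sets.sets_into_space[OF S] by auto
      then have "emeasure N {Inr n} \<le> emeasure N (space N - B)"
        using B by (intro emeasure_mono) auto
      then show False using B0 pos by simp
    qed
    then have t: "{x \<in> A. f x \<in> {Inr n}} \<in> sets \<nu>" "0 < emeasure \<nu> {x \<in> A. f x \<in> {Inr n}}"
      using transport[OF S] pos by auto
    have "{x \<in> A. f x \<in> {Inr n}} = {g (Inr n)}"
      using gf fg gA \<open>Inr n \<in> B\<close> by (auto, metis)
    with t have "is_atom \<nu> {g (Inr n)}" unfolding is_atom_def by (auto simp: subset_singleton_iff)
    then show False using na by blast
  qed
  have spN: "space N = Inl ` {0..a}" unfolding N_def space_interval_with_atoms using p0 by auto
  have emN: "emeasure N S = emeasure lebesgue (Inl -` S)" if "S \<in> sets N" for S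
  proof -
    have "p n = 0" for n using p0[of n] by (simp add: zero_less_iff_neq_zero)
    then show ?thesis using that unfolding N_def by (subst emeasure_interval_with_atoms) auto
  qed
  \<comment> \<open>The default \<open>0\<close> lies in \<open>{0..a}\<close>, so the bounds on
    \<phi> hold everywhere and not just on \<open>A\<close>.\<close>
  define \<phi> where "\<phi> x = (if x \<in> A then projl (f x) else 0)" for x
  have f_\<phi>: "f x = Inl (\<phi> x) \<and> \<phi> x \<in> {0..a}" if "x \<in> A" for x
    using fB[OF that] Bs that unfolding spN \<phi>_def by auto
  have preimage: "{x \<in> A. \<phi> x \<in> C} \<in> sets \<nu>" "emeasure \<nu> {x \<in> A. \<phi> x \<in> C} \<le> emeasure lborel C"
    if C: "C \<in> sets borel" for C
  proof -
    \<comment> \<open>\<open>transport\<close> applies to subsets of \<open>B\<close>, so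
      \<open>C\<close> is cut down first; the measure can only drop, hence an inequality.\<close>
    let ?S = "B \<inter> Inl ` (C \<inter> {0..a})"
    have vS: "Inl -` ?S = Inl -` B \<inter> (C \<inter> {0..a})" by auto
    have "Inl -` B \<in> sets lebesgue" using B unfolding N_def sets_interval_with_atoms by auto
    then have "Inl -` ?S \<in> sets lebesgue" unfolding vS using C by auto
    then have S: "?S \<in> sets N" using B unfolding N_def sets_interval_with_atoms by auto
    have eq: "{x \<in> A. f x \<in> ?S} = {x \<in> A. \<phi> x \<in> C}"
      using f_\<phi> fB by force
    have "emeasure N ?S = emeasure lebesgue (Inl -` ?S)" by (rule emN[OF S])
    also have "\<dots> \<le> emeasure lebesgue C" using C unfolding vS by (intro emeasure_mono) auto
    also have "\<dots> = emeasure lborel C" using C by simp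
    finally have "emeasure N ?S \<le> emeasure lborel C" .
    then show "{x \<in> A. \<phi> x \<in> C} \<in> sets \<nu>" "emeasure \<nu> {x \<in> A. \<phi> x \<in> C} \<le> emeasure lborel C"
      using transport[OF S] unfolding eq by auto
  qed
  show ?thesis
  proof
    show meas: "\<phi> \<in> borel_measurable \<nu>"
    proof (rule measurableI)
      fix C :: "real set" assume C: "C \<in> sets borel"
      have "\<phi> -` C \<inter> space \<nu> = {x \<in> A. \<phi> x \<in> C} \<union> (if 0 \<in> C then space \<nu> - A else {})"
        using As unfolding \<phi>_def by (auto split: if_splits)
      then show "\<phi> -` C \<inter> space \<nu> \<in> sets \<nu>" using preimage[OF C] A by auto
    qed simp
    show "inj_on \<phi> A"
      by (rule inj_onI) (metis f_\<phi> gf)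
    show "0 \<le> \<phi> x" "\<phi> x \<le> a" for x
    proof -
      have "\<phi> x = 0" if "x \<notin> A" using that by (simp add: \<phi>_def)
      then have "\<phi> x \<in> {0..a}" using f_\<phi>[of x] a by (cases "x \<in> A") auto
      then show "0 \<le> \<phi> x" "\<phi> x \<le> a" by auto
    qed
    show "emeasure \<nu> {x \<in> space \<nu>. \<bar>\<phi> x - c\<bar> < \<delta>} \<le> ennreal (2 * \<delta>)" if "0 < \<delta>" for c \<delta>
    proof -
      \<comment> \<open>Points outside \<open>A\<close> have the default code and may fall into the
        interval, but they form a null set.\<close>
      have "emeasure \<nu> {x \<in> space \<nu>. \<bar>\<phi> x - c\<bar> < \<delta>} \<le>
          emeasure \<nu> ({x \<in> A. \<phi> x \<in> {c - \<delta><..<c + \<delta>}} \<union> (space \<nu> - A))"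
        using A preimage(1)[of "{c - \<delta><..<c + \<delta>}"] by (intro emeasure_mono) auto
      also have "\<dots> \<le> emeasure \<nu> {x \<in> A. \<phi> x \<in> {c - \<delta><..<c + \<delta>}} + emeasure \<nu> (space \<nu> - A)"
        using A preimage(1)[of "{c - \<delta><..<c + \<delta>}"] by (intro emeasure_subadditive) auto
      also have "\<dots> \<le> emeasure lborel {c - \<delta><..<c + \<delta>}"
        using preimage(2)[of "{c - \<delta><..<c + \<delta>}"] A0 by simp
      also have "\<dots> = ennreal (2 * \<delta>)" using that by simp
      finally show ?thesis .
    qed
  qed (use A A0 in auto)
qed

section \<open>The coordinate semimetric and its translates under the shift\<close>

text \<open>Sequences that agree at \<open>0\<close> are at distance \<open>0\<close>; the other
  coordinates are seen by the translates under the shift.\<close>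

definition coordinate_semimetric :: "('a \<Rightarrow> real) \<Rightarrow> (int \<Rightarrow> 'a) \<Rightarrow> (int \<Rightarrow> 'a) \<Rightarrow> real" where
  "coordinate_semimetric \<phi> x y = \<bar>\<phi> (x 0) - \<phi> (y 0)\<bar>"

lemma space_bernoulli_measure:
  "space (bernoulli_measure \<nu>) = {x. \<forall>i. x i \<in> space \<nu>}"
  by (auto simp: bernoulli_measure_def space_PiM PiE_def Pi_def)

lemma left_shift_funpow: "(left_shift ^^ k) x = (\<lambda>i. x (i + int k))"
  by (induction k arbitrary: x) (auto simp: left_shift_def algebra_simps funpow_swap1)

text \<open>The shift is injective on the space, which leaves \<open>inv_into\<close> no choice: it
  must return the right shift.\<close>

lemma inv_left_shift:
  assumes "x \<in> space (bernoulli_measure \<nu>)"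
  shows "inv_into (space (bernoulli_measure \<nu>)) left_shift x = (\<lambda>i. x (i - 1))"
proof -
  have "inj_on left_shift (space (bernoulli_measure \<nu>))"
    by (rule inj_onI) (auto simp: left_shift_def fun_eq_iff, metis diff_add_cancel)
  moreover have "(\<lambda>i. x (i - 1)) \<in> space (bernoulli_measure \<nu>)"
    using assms by (simp add: space_bernoulli_measure)
  moreover have "left_shift (\<lambda>i. x (i - 1)) = x" by (simp add: left_shift_def)
  ultimately show ?thesis by (intro inv_into_f_eq)
qed

lemma inv_left_shift_funpow:
  assumes "x \<in> space (bernoulli_measure \<nu>)"
  shows "(inv_into (space (bernoulli_measure \<nu>)) left_shift ^^ k) x = (\<lambda>i. x (i - int k))"
  using assms
proof (induction k)
  case (Suc k)
  then have "(\<lambda>i. x (i - int k)) \<in> space (bernoulli_measure \<nu>)"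
    by (simp add: space_bernoulli_measure)
  then show ?case using Suc by (simp add: inv_left_shift algebra_simps)
qed simp

lemma int_iterate_left_shift:
  assumes "x \<in> space (bernoulli_measure \<nu>)"
  shows "int_iterate (space (bernoulli_measure \<nu>)) left_shift k x = (\<lambda>i. x (i + k))"
  using assms by (auto simp: int_iterate_def left_shift_funpow inv_left_shift_funpow)

text \<open>Only nonnegative powers of the shift enter the average, so \<open>inv_into\<close> never
  appears and \<open>S\<close> is arbitrary.\<close>

lemma average_coordinate_semimetric:
  "average_semimetric S left_shift n (coordinate_semimetric \<phi>) x y =
    (\<Sum>k<n. \<bar>\<phi> (x (int k)) - \<phi> (y (int k))\<bar>) / real n"
  by (simp add: average_semimetric_def translate_semimetric_def coordinate_semimetric_def
      int_iterate_def left_shift_funpow)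

lemma measurable_bernoulli_coordinate:
  assumes "\<phi> \<in> borel_measurable \<nu>"
  shows "(\<lambda>x. \<phi> (x i)) \<in> borel_measurable (bernoulli_measure \<nu>)"
  unfolding bernoulli_measure_def using assms
  by (intro measurable_completion measurable_compose[OF measurable_component_singleton]) auto

lemma prob_space_bernoulli_measure:
  assumes "prob_space \<nu>"
  shows "prob_space (bernoulli_measure \<nu>)"
  unfolding bernoulli_measure_def
  by (intro prob_space.prob_space_completion prob_space_PiM assms)

lemma measurable_coordinate_semimetric:
  assumes "\<phi> \<in> borel_measurable \<nu>"
  shows "measurable_semimetric (bernoulli_measure \<nu>) (coordinate_semimetric \<phi>)"
proof -
  note [measurable] = measurable_bernoulli_coordinate[OF assms]
  have "(\<lambda>(x, y). coordinate_semimetric \<phi> x y) \<in>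
      borel_measurable (bernoulli_measure \<nu> \<Otimes>\<^sub>M bernoulli_measure \<nu>)"
    unfolding coordinate_semimetric_def by measurable
  then show ?thesis
    by (auto simp: measurable_semimetric_def semimetric_on_def coordinate_semimetric_def
        intro!: measurable_completion)
qed

text \<open>The semimetric is pulled back from the real line, where every subset has a countable
  dense subset. One preimage for each point of such a subset of the image gives the dense set in
  \<open>S\<close>.\<close>

lemma separable_coordinate_semimetric: "separable_semimetric S (coordinate_semimetric \<phi>)"
proof -
  obtain E where E: "countable E" "E \<subseteq> (\<lambda>x. \<phi> (x 0)) ` S" "(\<lambda>x. \<phi> (x 0)) ` S \<subseteq> closure E"
    by (rule separable)
  obtain D where D: "D \<subseteq> S" "countable D" "E = (\<lambda>x. \<phi> (x 0)) ` D"
    using countable_subset_image[of E "\<lambda>x. \<phi> (x 0)" S] E by auto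
  have "\<exists>d\<in>D. coordinate_semimetric \<phi> x d < e" if x: "x \<in> S" and e: "0 < e" for x e
  proof -
    have "\<phi> (x 0) \<in> closure E" using E x by auto
    then obtain y where "y \<in> E" "dist y (\<phi> (x 0)) < e" using e unfolding closure_approachable by blast
    then show ?thesis unfolding D coordinate_semimetric_def
      by (auto simp: dist_real_def abs_minus_commute)
  qed
  then show ?thesis unfolding separable_semimetric_def using D by blast
qed

lemma admissible_coordinate_semimetric:
  assumes "\<phi> \<in> borel_measurable \<nu>"
  shows "admissible_semimetric (bernoulli_measure \<nu>) (coordinate_semimetric \<phi>)"
  unfolding admissible_semimetric_def full_measure_set_def
  using measurable_coordinate_semimetric[OF assms] separable_coordinate_semimetric
  by (intro conjI exI[of _ "space (bernoulli_measure \<nu>)"]) auto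

text \<open>The semimetric is bounded by \<open>a\<close> and the square is a probability
  space.\<close>

lemma summable_coordinate_semimetric:
  assumes \<nu>: "prob_space \<nu>" and bd: "\<And>x. 0 \<le> \<phi> x" "\<And>x. \<phi> x \<le> (a::real)"
  shows "summable_semimetric (bernoulli_measure \<nu>) (coordinate_semimetric \<phi>)"
proof -
  interpret prob_space "bernoulli_measure \<nu>" by (rule prob_space_bernoulli_measure[OF \<nu>])
  interpret P: pair_prob_space "bernoulli_measure \<nu>" "bernoulli_measure \<nu>" ..
  have "(\<integral>\<^sup>+ (x, y). ennreal (coordinate_semimetric \<phi> x y) \<partial>square_measure (bernoulli_measure \<nu>)) \<le>
      (\<integral>\<^sup>+ _. ennreal a \<partial>square_measure (bernoulli_measure \<nu>))"
  proof (rule nn_integral_mono, clarify)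
    fix x y :: "int \<Rightarrow> 'a"
    show "ennreal (coordinate_semimetric \<phi> x y) \<le> ennreal a"
      using bd[of "x 0"] bd[of "y 0"] unfolding coordinate_semimetric_def by (intro ennreal_leI) auto
  qed
  also have "\<dots> = ennreal a"
    by (simp add: nn_integral_completion P.emeasure_space_1)
  also have "\<dots> < \<infinity>" by simp
  finally show ?thesis unfolding summable_semimetric_def .
qed

text \<open>There are countably many coordinates, so almost every sequence lies in \<open>A\<close>
  at all of them. Two such sequences that differ at \<open>k\<close> have different codes there, and
  the translate by \<open>k\<close> sees this.\<close>

lemma generating_coordinate_semimetric:
  assumes \<nu>: "prob_space \<nu>" and \<phi>: "\<phi> \<in> borel_measurable \<nu>"
    and A: "A \<in> sets \<nu>" "emeasure \<nu> (space \<nu> - A) = 0" and inj: "inj_on \<phi> A"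
  shows "generating_semimetric (bernoulli_measure \<nu>) left_shift (coordinate_semimetric \<phi>)"
proof -
  interpret product_prob_space "\<lambda>_::int. \<nu>" UNIV
    using \<nu> by (simp add: product_prob_spaceI)
  let ?P = "PiM UNIV (\<lambda>_::int. \<nu>)"
  define X where "X = {x \<in> space ?P. \<forall>i::int. x i \<in> A}"
  have X[measurable]: "X \<in> sets ?P" unfolding X_def using A by measurable
  have "AE x in \<nu>. x \<in> A" using A by (intro AE_I[of _ _ "space \<nu> - A"]) auto
  then have "AE x in ?P. x i \<in> A" for i using AE_component[of i] by simp
  then have "AE x in ?P. \<forall>i. x i \<in> A" by (simp add: AE_all_countable)
  then have "AE x in ?P. x \<in> X" unfolding X_def by auto
  then have "emeasure ?P (space ?P - X) = 0"
    using X by (subst (asm) AE_iff_measurable[of "space ?P - X"]) auto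
  then have "full_measure_set (bernoulli_measure \<nu>) X"
    using X unfolding full_measure_set_def bernoulli_measure_def by auto
  moreover have "\<exists>k. 0 < translate_semimetric (space (bernoulli_measure \<nu>)) left_shift k (coordinate_semimetric \<phi>) x y"
    if xy: "x \<in> X" "y \<in> X" "x \<noteq> y" for x y
  proof -
    obtain k where "x k \<noteq> y k" using xy(3) by blast
    then have "\<phi> (x k) \<noteq> \<phi> (y k)" using that inj by (auto simp: X_def inj_on_def)
    moreover have "x \<in> space (bernoulli_measure \<nu>)" "y \<in> space (bernoulli_measure \<nu>)"
      using that by (auto simp: X_def bernoulli_measure_def)
    ultimately show ?thesis
      by (intro exI[of _ k])
        (simp add: translate_semimetric_def int_iterate_left_shift coordinate_semimetric_def)
  qed
  ultimately show ?thesis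
    unfolding generating_semimetric_def using measurable_coordinate_semimetric[OF \<phi>] by blast
qed

section \<open>Entropy and partitions; the linear upper bound\<close>

lemma eps_entropy_upper:
  assumes "eps_partition M \<rho> \<epsilon> k P" "1 \<le> k"
  shows "eps_entropy M \<rho> \<epsilon> \<le> ereal (log 2 (real k))"
proof -
  let ?Q = "\<lambda>k. 1 \<le> k \<and> (\<exists>P. eps_partition M \<rho> \<epsilon> k P)"
  have "?Q k" using assms by blast
  then have "?Q (LEAST k. ?Q k)" "(LEAST k. ?Q k) \<le> k" by (rule LeastI, rule Least_le)
  then have "log 2 (real (LEAST k. ?Q k)) \<le> log 2 (real k)" by simp
  with \<open>?Q k\<close> show ?thesis unfolding eps_entropy_def by auto
qed

lemma eps_entropy_lower:
  assumes "\<And>k P. eps_partition M \<rho> \<epsilon> k P \<Longrightarrow> 1 \<le> k \<Longrightarrow> c \<le> log 2 (real k)"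
  shows "ereal c \<le> eps_entropy M \<rho> \<epsilon>"
proof (cases "\<exists>k\<ge>1. \<exists>P. eps_partition M \<rho> \<epsilon> k P")
  case True
  let ?Q = "\<lambda>k. 1 \<le> k \<and> (\<exists>P. eps_partition M \<rho> \<epsilon> k P)"
  have "?Q (LEAST k. ?Q k)" by (rule LeastI_ex) (use True in simp)
  then obtain P where "eps_partition M \<rho> \<epsilon> (LEAST k. ?Q k) P" "1 \<le> (LEAST k. ?Q k)" by auto
  then have "c \<le> log 2 (real (LEAST k. ?Q k))" by (rule assms)
  then show ?thesis unfolding eps_entropy_def if_P[OF True] by simp
qed (auto simp: eps_entropy_def)

text \<open>The range of \<phi> is cut into \<open>m\<close> cells, and points are sorted by the
  cells of their first \<open>n\<close> coordinates. Each of the \<open>m ^ n\<close> names gives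
  one class, possibly empty.\<close>

lemma eps_entropy_average_le:
  assumes \<phi>: "\<phi> \<in> borel_measurable \<nu>" and bd: "\<And>x. 0 \<le> \<phi> x" "\<And>x. \<phi> x \<le> (a::real)" and \<epsilon>: "0 < \<epsilon>"
  obtains m :: nat where "\<And>n. 1 \<le> n \<Longrightarrow>
    eps_entropy (bernoulli_measure \<nu>)
      (average_semimetric (space (bernoulli_measure \<nu>)) left_shift n (coordinate_semimetric \<phi>)) \<epsilon>
    \<le> ereal (real n * log 2 (real m))"
proof -
  \<comment> \<open>Width \<open>\<epsilon> / 2\<close> rather than \<epsilon>: the diameter is a
    supremum and must stay strictly below \<epsilon>.\<close>
  define cell where "cell t = nat \<lfloor>\<phi> t / (\<epsilon> / 2)\<rfloor>" for t
  \<comment> \<open>\<open>Suc\<close> counts the cell that contains \<open>a\<close>, and it makes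
    \<open>m\<close> positive, as the logarithm needs.\<close>
  define m where "m = Suc (nat \<lfloor>a / (\<epsilon> / 2)\<rfloor>)"
  have cell_m: "cell t < m" for t
    unfolding cell_def m_def using bd[of t] \<epsilon>
    by (intro le_imp_less_Suc nat_mono floor_mono divide_right_mono) auto
  have cell_close: "\<bar>\<phi> s - \<phi> t\<bar> \<le> \<epsilon> / 2" if "cell s = cell t" for s t
  proof -
    have "\<lfloor>\<phi> s / (\<epsilon> / 2)\<rfloor> = \<lfloor>\<phi> t / (\<epsilon> / 2)\<rfloor>"
      using that bd[of s] bd[of t] \<epsilon> unfolding cell_def by (subst (asm) eq_nat_nat_iff) auto
    then have "\<bar>\<phi> s / (\<epsilon> / 2) - \<phi> t / (\<epsilon> / 2)\<bar> < 1" by linarith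
    then have "\<bar>\<phi> s - \<phi> t\<bar> / \<bar>\<epsilon> / 2\<bar> < 1" by (simp only: diff_divide_distrib flip: abs_divide)
    then show ?thesis using \<epsilon> by (simp add: pos_divide_less_eq)
  qed
  show ?thesis
  proof
    fix n :: nat assume n: "1 \<le> n"
    let ?\<rho> = "average_semimetric (space (bernoulli_measure \<nu>)) left_shift n (coordinate_semimetric \<phi>)"
    let ?F = "{..<n} \<rightarrow>\<^sub>E {..<m}"
    have cF: "card ?F = m ^ n" "finite ?F" by (auto simp: card_PiE intro: finite_PiE)
    \<comment> \<open>Names are numbered from \<open>1\<close>, since index \<open>0\<close> is
      reserved for the exceptional set, which is empty here.\<close>
    then obtain h where h: "bij_betw h {1..m ^ n} ?F"
      using ex_bij_betw_nat_finite_1[of ?F] by metis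
    define P where "P j = (if j = 0 then {} else
      {x \<in> space (bernoulli_measure \<nu>). \<forall>k<n. cell (x (int k)) = h j k})" for j
    have "eps_partition (bernoulli_measure \<nu>) ?\<rho> \<epsilon> (m ^ n) P"
      unfolding eps_partition_def
    proof (intro conjI allI impI ballI)
      have [measurable]: "Measurable.pred (bernoulli_measure \<nu>) (\<lambda>x. cell (x (int k)) = i)" for k i
        unfolding cell_def using measurable_bernoulli_coordinate[OF \<phi>, of "int k"] by measurable
      have "{x \<in> space (bernoulli_measure \<nu>). \<forall>k<n. cell (x (int k)) = h j k} \<in> sets (bernoulli_measure \<nu>)" for j
        by measurable
      then show "P j \<in> sets (bernoulli_measure \<nu>)" for j
        unfolding P_def by auto
      show "disjoint_family_on P {..m ^ n}"
        unfolding disjoint_family_on_def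
      proof (intro ballI impI)
        fix i j assume ij: "i \<in> {..m ^ n}" "j \<in> {..m ^ n}" "i \<noteq> j"
        show "P i \<inter> P j = {}"
        proof (cases "i = 0 \<or> j = 0")
          case False
          then have ij': "i \<in> {1..m ^ n}" "j \<in> {1..m ^ n}" using ij by auto
          then have "h i \<noteq> h j" "h i \<in> ?F" "h j \<in> ?F"
            using h ij(3) unfolding bij_betw_def inj_on_def by blast+
          then obtain k where "k < n" "h i k \<noteq> h j k"
            by (metis PiE_ext lessThan_iff)
          then show ?thesis using False unfolding P_def by auto
        qed (auto simp: P_def)
      qed
      show "(\<Union>j\<le>m ^ n. P j) = space (bernoulli_measure \<nu>)"
      proof
        show "(\<Union>j\<le>m ^ n. P j) \<subseteq> space (bernoulli_measure \<nu>)" by (auto simp: P_def split: if_splits)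
        show "space (bernoulli_measure \<nu>) \<subseteq> (\<Union>j\<le>m ^ n. P j)"
        proof
          fix x assume x: "x \<in> space (bernoulli_measure \<nu>)"
          have "restrict (\<lambda>k. cell (x (int k))) {..<n} \<in> h ` {1..m ^ n}"
            using h cell_m unfolding bij_betw_def by auto
          then obtain j where "j \<in> {1..m ^ n}" "h j = restrict (\<lambda>k. cell (x (int k))) {..<n}"
            by auto
          then show "x \<in> (\<Union>j\<le>m ^ n. P j)" using x by (intro UN_I[of j]) (auto simp: P_def)
        qed
      qed
      show "emeasure (bernoulli_measure \<nu>) (P 0) < ennreal \<epsilon>" using \<epsilon> by (simp add: P_def)
      fix j assume j: "j \<in> {1..m ^ n}"
      have "?\<rho> x y \<le> \<epsilon> / 2" if "x \<in> P j" "y \<in> P j" for x y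
      proof -
        have "(\<Sum>k<n. \<bar>\<phi> (x (int k)) - \<phi> (y (int k))\<bar>) \<le> (\<Sum>k<n. \<epsilon> / 2)"
          using that j by (intro sum_mono cell_close) (auto simp: P_def)
        then show ?thesis using n by (simp add: average_coordinate_semimetric field_simps)
      qed
      then have "semimetric_diameter ?\<rho> (P j) \<le> ennreal (\<epsilon> / 2)"
        unfolding semimetric_diameter_def by (intro SUP_least) (auto intro: ennreal_leI)
      also have "\<dots> < ennreal \<epsilon>" using \<epsilon> by (simp add: ennreal_lessI)
      finally show "semimetric_diameter ?\<rho> (P j) < ennreal \<epsilon>" .
    qed
    moreover have "1 \<le> m ^ n" by (simp add: m_def)
    ultimately have "eps_entropy (bernoulli_measure \<nu>) ?\<rho> \<epsilon> \<le> ereal (log 2 (real (m ^ n)))"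
      by (rule eps_entropy_upper)
    also have "log 2 (real (m ^ n)) = real n * log 2 (real m)"
      by (simp add: log_nat_power m_def)
    finally show "eps_entropy (bernoulli_measure \<nu>) ?\<rho> \<epsilon> \<le> ereal (real n * log 2 (real m))" .
  qed
qed

section \<open>Exponential moments and small balls; the linear lower bound\<close>

text \<open>The integrand depends on finitely many coordinates. Restriction to them pushes the
  infinite product to a finite one, where the integral of a product factorises.\<close>

lemma nn_integral_bernoulli_prod:
  assumes \<nu>: "prob_space \<nu>" and F: "\<And>k. F k \<in> borel_measurable \<nu>"
  shows "(\<integral>\<^sup>+ x. (\<Prod>k<n. F k (x (int k))) \<partial>bernoulli_measure \<nu>) = (\<Prod>k<n. \<integral>\<^sup>+ t. F k t \<partial>\<nu>)"
proof -
  interpret product_prob_space "\<lambda>_::int. \<nu>" UNIV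
    using \<nu> by (simp add: product_prob_spaceI)
  note [measurable] = F
  let ?J = "int ` {..<n}"
  have "(\<integral>\<^sup>+ x. (\<Prod>k<n. F k (x (int k))) \<partial>bernoulli_measure \<nu>) =
      (\<integral>\<^sup>+ x. (\<Prod>i\<in>?J. F (nat i) (x i)) \<partial>PiM UNIV (\<lambda>_. \<nu>))"
    unfolding bernoulli_measure_def nn_integral_completion by (simp add: prod.reindex)
  also have "\<dots> = (\<integral>\<^sup>+ x. (\<Prod>i\<in>?J. F (nat i) (restrict x ?J i)) \<partial>PiM UNIV (\<lambda>_. \<nu>))"
    by simp
  also have "\<dots> = (\<integral>\<^sup>+ x. (\<Prod>i\<in>?J. F (nat i) (x i)) \<partial>distr (PiM UNIV (\<lambda>_. \<nu>)) (PiM ?J (\<lambda>_. \<nu>)) (\<lambda>x. restrict x ?J))"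
    by (subst nn_integral_distr) auto
  also have "\<dots> = (\<integral>\<^sup>+ x. (\<Prod>i\<in>?J. F (nat i) (x i)) \<partial>PiM ?J (\<lambda>_. \<nu>))"
    by (subst distr_PiM_restrict_finite) auto
  also have "\<dots> = (\<Prod>i\<in>?J. \<integral>\<^sup>+ t. F (nat i) t \<partial>\<nu>)"
    by (intro product_nn_integral_prod) auto
  also have "\<dots> = (\<Prod>k<n. \<integral>\<^sup>+ t. F k t \<partial>\<nu>)"
    by (simp add: prod.reindex)
  finally show ?thesis .
qed

text \<open>Both follow from \<open>1 + x \<le> exp x\<close>, taken at \<open>1\<close> and
  squared, and taken at \<open>-1/4\<close>.\<close>

lemma exp_bounds: "exp (-2::real) \<le> 1/4" "exp (1/4::real) \<le> 3/2"
proof -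
  have "(2::real) \<le> exp 1" using exp_ge_add_one_self[of "1::real"] by simp
  then have "2 ^ 2 \<le> exp (1::real) ^ 2" by (intro power_mono) auto
  then have "4 \<le> exp (2::real)" by (simp add: exp_of_nat_mult[symmetric])
  then show "exp (-2::real) \<le> 1/4" by (simp add: exp_minus field_simps)
  have "3/4 \<le> exp (-(1/4)::real)" using exp_ge_add_one_self[of "-(1/4)::real"] by simp
  then have "exp (1/4::real) \<le> 4/3" by (simp add: exp_minus field_simps)
  then show "exp (1/4::real) \<le> 3/2" by simp
qed

text \<open>Split at distance \<open>1/8\<close> from \<open>c\<close>. Near \<open>c\<close> the
  integrand is at most \<open>exp (16/64)\<close>, hence at most \<open>3/2\<close>, on a set of
  measure at most \<open>1/4\<close>. Far from \<open>c\<close> it is at most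
  \<open>exp (1/4 - 2)\<close>, hence at most \<open>3/8\<close>. Each part contributes at most
  \<open>3/8\<close>.\<close>

lemma exp_moment_le:
  fixes \<phi> :: "'a \<Rightarrow> real"
  assumes \<nu>: "prob_space \<nu>" and \<phi>: "\<phi> \<in> borel_measurable \<nu>"
    and small: "emeasure \<nu> {x \<in> space \<nu>. \<bar>\<phi> x - c\<bar> < 1/8} \<le> ennreal (1/4)"
    and \<epsilon>: "\<epsilon> \<le> 1/64"
  shows "(\<integral>\<^sup>+ t. ennreal (exp (16 * (\<epsilon> - \<bar>\<phi> t - c\<bar>))) \<partial>\<nu>) \<le> ennreal (3/4)"
proof -
  interpret prob_space \<nu> by (rule \<nu>)
  note [measurable] = \<phi>
  let ?S = "{x \<in> space \<nu>. \<bar>\<phi> x - c\<bar> < 1/8}"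
  have S: "?S \<in> sets \<nu>" by measurable
  have "(\<integral>\<^sup>+ t. ennreal (exp (16 * (\<epsilon> - \<bar>\<phi> t - c\<bar>))) \<partial>\<nu>) \<le>
      (\<integral>\<^sup>+ t. ennreal (3/2) * indicator ?S t + ennreal (3/8) \<partial>\<nu>)"
  proof (rule nn_integral_mono)
    fix t assume t: "t \<in> space \<nu>"
    show "ennreal (exp (16 * (\<epsilon> - \<bar>\<phi> t - c\<bar>))) \<le> ennreal (3/2) * indicator ?S t + ennreal (3/8)"
    proof (cases "\<bar>\<phi> t - c\<bar> < 1/8")
      case True
      have "exp (16 * (\<epsilon> - \<bar>\<phi> t - c\<bar>)) \<le> exp (1/4)"
        using \<epsilon> abs_ge_zero[of "\<phi> t - c"] by (simp del: abs_ge_zero)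
      also have "\<dots> \<le> 3/2" by (rule exp_bounds)
      finally have "ennreal (exp (16 * (\<epsilon> - \<bar>\<phi> t - c\<bar>))) \<le> ennreal (3/2)" by (rule ennreal_leI)
      then show ?thesis using True t by (simp add: add_increasing2)
    next
      case False
      have "exp (16 * (\<epsilon> - \<bar>\<phi> t - c\<bar>)) \<le> exp (1/4 + (-2))" using \<epsilon> False by simp
      also have "\<dots> = exp (1/4) * exp (-2)" by (rule exp_add)
      also have "\<dots> \<le> 3/2 * (1/4)" by (intro mult_mono exp_bounds) auto
      finally have "ennreal (exp (16 * (\<epsilon> - \<bar>\<phi> t - c\<bar>))) \<le> ennreal (3/8)" by (intro ennreal_leI) simp
      then show ?thesis using False by simp
    qed
  qed
  also have "\<dots> = ennreal (3/2) * emeasure \<nu> ?S + ennreal (3/8)"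
    using S by (simp add: nn_integral_add nn_integral_cmult emeasure_space_1)
  also have "\<dots> \<le> ennreal (3/2) * ennreal (1/4) + ennreal (3/8)"
    by (intro add_right_mono mult_left_mono small) auto
  also have "\<dots> = ennreal (3/4)" by (simp add: ennreal_mult[symmetric] ennreal_plus[symmetric] del: ennreal_plus)
  finally show ?thesis .
qed

text \<open>Chernoff bound with parameter \<open>16\<close>: on the ball the total exponent is
  nonnegative, so the exponential dominates the indicator. By independence its integral is a product
  of \<open>n\<close> moments, each at most \<open>3/4\<close> whatever the centre.\<close>

lemma small_ball:
  fixes \<phi> :: "'a \<Rightarrow> real"
  assumes \<nu>: "prob_space \<nu>" and \<phi>: "\<phi> \<in> borel_measurable \<nu>"
    and small: "\<And>c. emeasure \<nu> {x \<in> space \<nu>. \<bar>\<phi> x - c\<bar> < 1/8} \<le> ennreal (1/4)"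
    and \<epsilon>: "\<epsilon> \<le> 1/64"
  shows "emeasure (bernoulli_measure \<nu>)
    {x \<in> space (bernoulli_measure \<nu>). (\<Sum>k<n. \<bar>\<phi> (x (int k)) - c k\<bar>) \<le> real n * \<epsilon>} \<le> ennreal ((3/4) ^ n)"
    (is "emeasure ?M ?S \<le> _")
proof -
  note [measurable] = \<phi> measurable_bernoulli_coordinate[OF \<phi>]
  have S: "?S \<in> sets ?M" by measurable
  let ?F = "\<lambda>k t. ennreal (exp (16 * (\<epsilon> - \<bar>\<phi> t - c k\<bar>)))"
  have "emeasure ?M ?S = (\<integral>\<^sup>+ x. indicator ?S x \<partial>?M)" using S by simp
  also have "\<dots> \<le> (\<integral>\<^sup>+ x. (\<Prod>k<n. ?F k (x (int k))) \<partial>?M)"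
  proof (rule nn_integral_mono)
    fix x
    have "(\<Prod>k<n. ?F k (x (int k))) = ennreal (exp (\<Sum>k<n. 16 * (\<epsilon> - \<bar>\<phi> (x (int k)) - c k\<bar>)))"
      by (simp add: prod_ennreal exp_sum)
    moreover have "1 \<le> exp (\<Sum>k<n. 16 * (\<epsilon> - \<bar>\<phi> (x (int k)) - c k\<bar>))" if "x \<in> ?S"
      using that by (simp add: sum_distrib_left[symmetric] sum_subtractf)
    ultimately show "indicator ?S x \<le> (\<Prod>k<n. ?F k (x (int k)))"
      by (auto simp: indicator_def)
  qed
  also have "\<dots> = (\<Prod>k<n. \<integral>\<^sup>+ t. ?F k t \<partial>\<nu>)"
    by (intro nn_integral_bernoulli_prod \<nu>) measurable
  also have "\<dots> \<le> (\<Prod>k<n. ennreal (3/4))"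
    by (intro prod_mono_ennreal exp_moment_le \<nu> \<phi> small \<epsilon>)
  also have "\<dots> = ennreal ((3/4) ^ n)" by (simp add: ennreal_power)
  finally show ?thesis .
qed

text \<open>A cell of small diameter lies in the ball around any of its points, so its measure is at
  most \<open>(3/4) ^ n\<close>. Together the \<open>k\<close> cells must cover all but the
  exceptional set, hence at least half of the space.\<close>

lemma eps_partition_card_ge:
  fixes \<phi> :: "'a \<Rightarrow> real"
  assumes \<nu>: "prob_space \<nu>" and \<phi>: "\<phi> \<in> borel_measurable \<nu>"
    and small: "\<And>c. emeasure \<nu> {x \<in> space \<nu>. \<bar>\<phi> x - c\<bar> < 1/8} \<le> ennreal (1/4)"
    and \<epsilon>: "0 < \<epsilon>" "\<epsilon> \<le> 1/64" and n: "1 \<le> n"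
    and P: "eps_partition (bernoulli_measure \<nu>)
      (average_semimetric (space (bernoulli_measure \<nu>)) left_shift n (coordinate_semimetric \<phi>)) \<epsilon> k P"
  shows "(4/3) ^ n / 2 \<le> real k"
proof -
  let ?M = "bernoulli_measure \<nu>"
  let ?\<rho> = "average_semimetric (space ?M) left_shift n (coordinate_semimetric \<phi>)"
  interpret prob_space ?M by (rule prob_space_bernoulli_measure[OF \<nu>])
  note [measurable] = measurable_bernoulli_coordinate[OF \<phi>]
  have sets: "P j \<in> sets ?M" if "j \<le> k" for j using P that unfolding eps_partition_def by blast
  have cell: "emeasure ?M (P j) \<le> ennreal ((3/4) ^ n)" if j: "j \<in> {1..k}" for j
  proof (cases "P j = {}")
    case False
    then obtain y where y: "y \<in> P j" by blast
    have Pj: "P j \<subseteq> space ?M" using sets j sets.sets_into_space by auto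
    have "(\<Sum>k<n. \<bar>\<phi> (x (int k)) - \<phi> (y (int k))\<bar>) \<le> real n * \<epsilon>" if "x \<in> P j" for x
    proof -
      have "ennreal (?\<rho> x y) \<le> semimetric_diameter ?\<rho> (P j)"
        unfolding semimetric_diameter_def using that y by (intro SUP_upper2[of "(x, y)"]) auto
      also have "\<dots> < ennreal \<epsilon>" using P j unfolding eps_partition_def by blast
      finally have "?\<rho> x y < \<epsilon>" using \<epsilon> by (simp add: ennreal_less_iff average_coordinate_semimetric sum_nonneg)
      then show ?thesis using n by (simp add: average_coordinate_semimetric field_simps)
    qed
    then have "emeasure ?M (P j) \<le> emeasure ?M
        {x \<in> space ?M. (\<Sum>k<n. \<bar>\<phi> (x (int k)) - \<phi> (y (int k))\<bar>) \<le> real n * \<epsilon>}"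
      using Pj by (intro emeasure_mono) auto
    also have "\<dots> \<le> ennreal ((3/4) ^ n)" by (rule small_ball[OF \<nu> \<phi> small \<epsilon>(2)])
    finally show ?thesis .
  qed simp
  have "1 = emeasure ?M (\<Union>j\<le>k. P j)"
    using P unfolding eps_partition_def by (simp add: emeasure_space_1)
  also have "\<dots> \<le> (\<Sum>j\<le>k. emeasure ?M (P j))"
    using sets by (intro emeasure_subadditive_finite) auto
  also have "\<dots> = emeasure ?M (P 0) + (\<Sum>j\<in>{1..k}. emeasure ?M (P j))"
    by (simp add: atMost_atLeast0 sum.atLeast_Suc_atMost)
  also have "\<dots> \<le> ennreal \<epsilon> + (\<Sum>j\<in>{1..k}. ennreal ((3/4) ^ n))"
    using P cell unfolding eps_partition_def by (intro add_mono sum_mono) auto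
  also have "\<dots> = ennreal (\<epsilon> + real k * (3/4) ^ n)"
    using \<epsilon> by (simp add: ennreal_mult ennreal_of_nat_eq_real_of_nat)
  finally have "1 \<le> \<epsilon> + real k * (3/4) ^ n"
    by simp
  \<comment> \<open>The exceptional set has measure below \<open>1/64\<close>; \<open>1/2\<close> is
    a convenient weaker bound for what remains.\<close>
  then have "1/2 \<le> real k * (3/4) ^ n" using \<epsilon> by linarith
  then have "1/2 * (4/3) ^ n \<le> real k * (3/4) ^ n * (4/3) ^ n" by (intro mult_right_mono) auto
  also have "\<dots> = real k" by (simp add: mult.assoc power_mult_distrib[symmetric])
  finally show ?thesis by simp
qed

section \<open>Linear growth of the entropy\<close>

lemma scaling_sequence_coordinate_semimetric:
  fixes \<phi> :: "'a \<Rightarrow> real"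
  assumes \<nu>: "prob_space \<nu>" and \<phi>: "\<phi> \<in> borel_measurable \<nu>"
    and bd: "\<And>x. 0 \<le> \<phi> x" "\<And>x. \<phi> x \<le> a"
    and small: "\<And>c. emeasure \<nu> {x \<in> space \<nu>. \<bar>\<phi> x - c\<bar> < 1/8} \<le> ennreal (1/4)"
  shows "scaling_sequence (bernoulli_measure \<nu>) left_shift (coordinate_semimetric \<phi>) (\<lambda>n. real n)"
proof -
  let ?H = "\<lambda>\<epsilon> n. eps_entropy (bernoulli_measure \<nu>)
    (average_semimetric (space (bernoulli_measure \<nu>)) left_shift n (coordinate_semimetric \<phi>)) \<epsilon>"
  have "limsup (\<lambda>n. ?H \<epsilon> n / ereal (real n)) < \<infinity>" if \<epsilon>: "0 < \<epsilon>" for \<epsilon>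
  proof -
    obtain m where m: "\<And>n. 1 \<le> n \<Longrightarrow> ?H \<epsilon> n \<le> ereal (real n * log 2 (real m))"
      using eps_entropy_average_le[OF \<phi> bd \<epsilon>] by blast
    have "?H \<epsilon> n / ereal (real n) \<le> ereal (log 2 (real m))" if "1 \<le> n" for n
      using m[OF that] that by (simp add: ereal_divide_le_pos)
    then have "limsup (\<lambda>n. ?H \<epsilon> n / ereal (real n)) \<le> ereal (log 2 (real m))"
      by (intro Limsup_bounded) (auto simp: eventually_sequentially)
    then show ?thesis by (rule order.strict_trans1) simp
  qed
  moreover have "0 < liminf (\<lambda>n. ?H \<epsilon> n / ereal (real n))" if \<epsilon>: "0 < \<epsilon>" "\<epsilon> \<le> 1/64" for \<epsilon>
  proof -
    \<comment> \<open>The growth rate from the cell count \<open>(4/3) ^ n / 2\<close>; the factor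
      \<open>1/2\<close> costs the \<open>- 1\<close> in \<open>low\<close>.\<close>
    define c where "c = log 2 (4/3 :: real)"
    have c: "0 < c" unfolding c_def by simp
    have low: "ereal (real n * c - 1) \<le> ?H \<epsilon> n" if n: "1 \<le> n" for n
    proof (rule eps_entropy_lower)
      fix k P
      assume "eps_partition (bernoulli_measure \<nu>)
        (average_semimetric (space (bernoulli_measure \<nu>)) left_shift n (coordinate_semimetric \<phi>)) \<epsilon> k P"
      from eps_partition_card_ge[OF \<nu> \<phi> small \<epsilon> n this]
      have "(4/3) ^ n / 2 \<le> real k" .
      moreover assume "1 \<le> k"
      ultimately have "log 2 ((4/3) ^ n / 2) \<le> log 2 (real k)" by simp
      then show "real n * c - 1 \<le> log 2 (real k)"
        by (simp add: log_divide log_nat_power c_def)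
    qed
    \<comment> \<open>Once \<open>n\<close> is at least \<open>2 / c\<close>, half of
      \<open>real n * c\<close> absorbs the lost \<open>1\<close>. The \<open>+ 1\<close> in the
      threshold ensures that \<open>n\<close> is positive.\<close>
    have "ereal (c / 2) \<le> ?H \<epsilon> n / ereal (real n)" if n: "nat \<lceil>2 / c\<rceil> + 1 \<le> n" for n
    proof -
      have "2 / c \<le> real n" using n by linarith
      then have "real n * (c / 2) \<le> real n * c - 1" using c by (simp add: field_simps)
      then have "ereal (real n * (c / 2)) \<le> ereal (real n * c - 1)" by simp
      also have "\<dots> \<le> ?H \<epsilon> n" using n by (intro low) simp
      finally show ?thesis using n by (simp add: ereal_le_divide_pos)
    qed
    then have "ereal (c / 2) \<le> liminf (\<lambda>n. ?H \<epsilon> n / ereal (real n))"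
      by (intro Liminf_bounded) (auto simp: eventually_sequentially)
    moreover have "0 < ereal (c / 2)" using c by simp
    ultimately show ?thesis by (rule order.strict_trans2[rotated])
  qed
  then have "\<forall>\<^sub>F \<epsilon> in at_right 0. 0 < liminf (\<lambda>n. ?H \<epsilon> n / ereal (real n))"
    by (intro eventually_at_rightI[of 0 "1/64"]) auto
  ultimately show ?thesis unfolding scaling_sequence_def by auto
qed

theorem theorem3:
  fixes \<nu> :: "'a measure"
  assumes "standard_prob_space \<nu>"
    and "\<nexists>A. is_atom \<nu> A"
  shows "scaling_entropy_sequence (bernoulli_measure \<nu>) left_shift (\<lambda>n. real n)"
proof -
  have \<nu>: "prob_space \<nu>" using assms(1) unfolding standard_prob_space_def by blast
  obtain \<phi> :: "'a \<Rightarrow> real" and A a where \<phi>: "\<phi> \<in> borel_measurable \<nu>"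
    and A: "A \<in> sets \<nu>" "emeasure \<nu> (space \<nu> - A) = 0" "inj_on \<phi> A"
    and bd: "\<And>x. 0 \<le> \<phi> x" "\<And>x. \<phi> x \<le> a"
    and small: "\<And>c \<delta>. 0 < \<delta> \<Longrightarrow> emeasure \<nu> {x \<in> space \<nu>. \<bar>\<phi> x - c\<bar> < \<delta>} \<le> ennreal (2 * \<delta>)"
    by (rule nonatomic_coding[OF assms]) (rule that)
  \<comment> \<open>Radius \<open>1/8\<close> gives an interval of length \<open>1/4\<close>, the
    mass allowed near a point in the moment estimate.\<close>
  have "emeasure \<nu> {x \<in> space \<nu>. \<bar>\<phi> x - c\<bar> < 1/8} \<le> ennreal (1/4)" for c
    using small[of "1/8" c] by simp
  then have "scaling_sequence (bernoulli_measure \<nu>) left_shift (coordinate_semimetric \<phi>) (\<lambda>n. real n)"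
    by (rule scaling_sequence_coordinate_semimetric[OF \<nu> \<phi> bd])
  then show ?thesis
    unfolding scaling_entropy_sequence_def
    using admissible_coordinate_semimetric[OF \<phi>] summable_coordinate_semimetric[where \<phi> = \<phi>, OF \<nu> bd]
      generating_coordinate_semimetric[OF \<nu> \<phi> A] by blast
qed

end
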